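(* Let $(\mu,\nu,\mathcal C)$ be a Gårding–Wightman triple on $X=\mathbb Z_2^\infty$ and $V=V(\mu,\nu,\mathcal C)$. If $\mu$ is discrete and $V$ is irreducible over $\mathbb C$, then $V$ is irreducible over $\mathbb R$. In particular, this is the case for the Fermi–Fock representation $V(\mu_\Delta,1,\{1\})$.
   Context: $X=\mathbb Z_2^{\infty}$ is the compact abelian group of sequences $x=(x_1,x_2,\dots)$ of $0$'s and $1$'s with componentwise addition mod $2$, the product topology and its Borel $\sigma$-algebra. $\delta^k\in X$ has a $1$ in position $k$ and $0$ elsewhere; $\Delta\subset X$ is the subgroup of sequences with finitely many $1$'s. A Gårding–Wightman triple $(\mu,\nu,\mathcal C)$ consists of: (1) a $\sigma$-finite positive Borel measure $\mu$ on $X$, quasi-invariant under $\Delta$, i.e. for each $\delta\in\Delta$ the measure $A\mapsto\mu(A+\delta)$ is mutually absolutely continuous with $\mu$; (2) a family $\{V_x\}_{x\in X}$ of nonzero separable complex Hilbert spaces with $V_{x+\delta}=V_x$ for $\delta\in\Delta$ and almost all $x$, and with $\nu(x)=\dim V_x$ measurable (up to unitary change, $V_x$ is a fixed model Hilbert space of dimension $\nu(x)$); (3) a family $\mathcal C=\{c_k(x):k\ge 1,x\in X\}$ of unitary operators $c_k(x):V_x\to V_{x+\delta^k}=V_x$, depending measurably on $x$, with $c_k(x)^*=c_k(x+\delta^k)$ and $c_k(x)c_l(x+\delta^k)=c_l(x)c_k(x+\delta^l)$ for all $k,l$ and almost all $x$. $V=V(\mu,\nu,\mathcal C)=\int_X^\oplus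 V_x\,d\mu(x)$ carries the mutually anticommuting unitary operators of square $-I$ ($k\ge1$) $$J_kf(x)=-i(-1)^{x_1+\dots+x_{k-1}}c_k(x)\sqrt{\tfrac{d\mu(x+\delta^k)}{d\mu(x)}}f(x+\delta^k),\quad J_k'f(x)=(-1)^{x_1+\dots+x_{k}}c_k(x)\sqrt{\tfrac{d\mu(x+\delta^k)}{d\mu(x)}}f(x+\delta^k),$$ where $d\mu(x+\delta^k)/d\mu(x)$ is the Radon–Nikodym derivative of $A\mapsto\mu(A+\delta^k)$ with respect to $\mu$; they define a representation of the Clifford algebra $C(H)$ of an infinite-dimensional separable real prehilbert space $H$. $\mu$ discrete means concentrated on a countable set of points. Irreducible over $\mathbb C$ (resp. over $\mathbb R$) means that $V\neq0$ has no closed complex-linear (resp. real-linear) subspace, other than $0$ and $V$, invariant under all $J_k,J_k'$. $\mu_\Delta$ is the measure concentrated on $\Delta$ with $\mu_\Delta(\{\delta\})=1$ for each $\delta\in\Delta$; $V(\mu_\Delta,1,\{1\})$ is the case $V_x=\mathbb C$, $c_k(x)=1$. *)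

theory Defs
  imports "HOL-Analysis.Analysis"
begin

text \<open>
  The group \<open>X = \<int>\<^sub>2\<^sup>\<infinity>\<close> is the type \<open>nat \<Rightarrow> bool\<close> (\<open>True\<close> is the residue \<open>1\<close>); its library topology
  is the product of the discrete topologies, and its Borel sets are those of \<open>borel\<close>.
  Positions are counted from \<open>0\<close>, so \<open>x k\<close> is the entry \<open>x\<^sub>k\<^sub>+\<^sub>1\<close> of the usual one-based notation.
\<close>

type_synonym seqX = "nat \<Rightarrow> bool"

definition plusX :: "seqX \<Rightarrow> seqX \<Rightarrow> seqX"  (infixl "\<oplus>\<^sub>2" 65)
  where "x \<oplus>\<^sub>2 y = (\<lambda>k. x k \<noteq> y k)"

definition delta :: "nat \<Rightarrow> seqX"
  where "delta k = (\<lambda>j. j = k)"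

definition Delta :: "seqX set"
  where "Delta = {x. finite {k. x k}}"

text \<open>Since translations are involutions, this is the measure \<open>A \<mapsto> \<mu>(A + d)\<close>.\<close>

definition translate :: "seqX \<Rightarrow> seqX measure \<Rightarrow> seqX measure"
  where "translate d \<mu> = distr \<mu> borel (\<lambda>x. x \<oplus>\<^sub>2 d)"

definition quasi_invariant :: "seqX measure \<Rightarrow> bool"
  where "quasi_invariant \<mu> \<longleftrightarrow>
    (\<forall>d\<in>Delta. absolutely_continuous \<mu> (translate d \<mu>) \<and> absolutely_continuous (translate d \<mu>) \<mu>)"

definition discrete_measure :: "seqX measure \<Rightarrow> bool"
  where "discrete_measure \<mu> \<longleftrightarrow> (\<exists>D. countable D \<and> (AE x in \<mu>. x \<in> D))"

text \<open>
  The model Hilbert space of dimension \<open>n \<le> \<infinity>\<close>: the square-summable complex sequences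
  supported on the first \<open>n\<close> coordinates. The fibre \<open>V\<^sub>x\<close> is \<open>model_space (\<nu> x)\<close>, so that
  \<open>V\<^sub>x = V\<^sub>y\<close> amounts to \<open>\<nu> x = \<nu> y\<close>.
\<close>

definition model_space :: "enat \<Rightarrow> (nat \<Rightarrow> complex) set"
  where "model_space n =
    {v. summable (\<lambda>j. (cmod (v j))\<^sup>2) \<and> (\<forall>j. n \<le> enat j \<longrightarrow> v j = 0)}"

definition inner_l2 :: "(nat \<Rightarrow> complex) \<Rightarrow> (nat \<Rightarrow> complex) \<Rightarrow> complex"
  where "inner_l2 u v = (\<Sum>j. u j * cnj (v j))"

definition unitary_between ::
  "(nat \<Rightarrow> complex) set \<Rightarrow> (nat \<Rightarrow> complex) set \<Rightarrow> ((nat \<Rightarrow> complex) \<Rightarrow> nat \<Rightarrow> complex) \<Rightarrow> bool"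
  where "unitary_between V W T \<longleftrightarrow>
    (\<forall>u\<in>V. \<forall>v\<in>V. \<forall>a b. T (\<lambda>j. a * u j + b * v j) = (\<lambda>j. a * T u j + b * T v j)) \<and>
    T ` V = W \<and>
    (\<forall>u\<in>V. \<forall>v\<in>V. inner_l2 (T u) (T v) = inner_l2 u v)"

text \<open>
  Vector fields are functions rather than classes modulo null sets. Measurability refers to the
  completion of \<open>\<mu>\<close>, so that changing a field on a null set is harmless.
\<close>

definition measurable_field ::
  "seqX measure \<Rightarrow> (seqX \<Rightarrow> enat) \<Rightarrow> (seqX \<Rightarrow> nat \<Rightarrow> complex) \<Rightarrow> bool"
  where "measurable_field \<mu> \<nu> f \<longleftrightarrow>
    (\<forall>j. (\<lambda>x. f x j) \<in> borel_measurable (completion \<mu>)) \<and>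
    (AE x in \<mu>. f x \<in> model_space (\<nu> x))"

text \<open>
  A field of operators is measurable if it maps measurable vector fields to measurable vector
  fields. The value \<open>c k x\<close> is relevant only on \<open>V\<^sub>x\<close>.
\<close>

definition GW_triple ::
  "seqX measure \<Rightarrow> (seqX \<Rightarrow> enat) \<Rightarrow> (nat \<Rightarrow> seqX \<Rightarrow> (nat \<Rightarrow> complex) \<Rightarrow> nat \<Rightarrow> complex) \<Rightarrow> bool"
  where "GW_triple \<mu> \<nu> c \<longleftrightarrow>
    sets \<mu> = sets borel \<and> sigma_finite_measure \<mu> \<and> quasi_invariant \<mu> \<and>
    (\<forall>x. \<nu> x \<noteq> 0) \<and>
    \<nu> \<in> measurable (completion \<mu>) (count_space UNIV) \<and>
    (\<forall>d\<in>Delta. AE x in \<mu>. \<nu> (x \<oplus>\<^sub>2 d) = \<nu> x) \<and>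
    (\<forall>k. AE x in \<mu>.
       unitary_between (model_space (\<nu> x)) (model_space (\<nu> (x \<oplus>\<^sub>2 delta k))) (c k x)) \<and>
    (\<forall>k f. measurable_field \<mu> \<nu> f \<longrightarrow> measurable_field \<mu> \<nu> (\<lambda>x. c k x (f x))) \<and>
    (\<forall>k. AE x in \<mu>. \<forall>u\<in>model_space (\<nu> x). \<forall>v\<in>model_space (\<nu> x).
       inner_l2 (c k x u) v = inner_l2 u (c k (x \<oplus>\<^sub>2 delta k) v)) \<and>
    (\<forall>k l. AE x in \<mu>. \<forall>v\<in>model_space (\<nu> x).
       c k x (c l (x \<oplus>\<^sub>2 delta k) v) = c l x (c k (x \<oplus>\<^sub>2 delta l) v))"

definition sq_norm :: "seqX measure \<Rightarrow> (seqX \<Rightarrow> nat \<Rightarrow> complex) \<Rightarrow> ennreal"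
  where "sq_norm \<mu> f = (\<integral>\<^sup>+x. (\<Sum>j. ennreal ((cmod (f x j))\<^sup>2)) \<partial>completion \<mu>)"

text \<open>
  The direct integral \<open>\<integral>\<^sup>\<oplus> V\<^sub>x d\<mu>(x)\<close>, as the space of representatives, seminormed by the square
  root of \<open>sq_norm\<close>. Its closed subspaces contain all null fields and correspond to the closed
  subspaces of the Hilbert space of classes modulo null fields; the zero subspace corresponds to
  \<open>null_fields\<close>.
\<close>

definition direct_integral ::
  "seqX measure \<Rightarrow> (seqX \<Rightarrow> enat) \<Rightarrow> (seqX \<Rightarrow> nat \<Rightarrow> complex) set"
  where "direct_integral \<mu> \<nu> = {f. measurable_field \<mu> \<nu> f \<and> sq_norm \<mu> f < \<infinity>}"

definition null_fields ::
  "seqX measure \<Rightarrow> (seqX \<Rightarrow> enat) \<Rightarrow> (seqX \<Rightarrow> nat \<Rightarrow> complex) set"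
  where "null_fields \<mu> \<nu> = {f \<in> direct_integral \<mu> \<nu>. AE x in \<mu>. f x = (\<lambda>j. 0)}"

definition RN_factor :: "seqX measure \<Rightarrow> nat \<Rightarrow> seqX \<Rightarrow> complex"
  where "RN_factor \<mu> k x =
    complex_of_real (sqrt (enn2real (RN_deriv \<mu> (translate (delta k) \<mu>) x)))"

definition opJ ::
  "seqX measure \<Rightarrow> (nat \<Rightarrow> seqX \<Rightarrow> (nat \<Rightarrow> complex) \<Rightarrow> nat \<Rightarrow> complex) \<Rightarrow> nat \<Rightarrow>
   (seqX \<Rightarrow> nat \<Rightarrow> complex) \<Rightarrow> seqX \<Rightarrow> nat \<Rightarrow> complex"
  where "opJ \<mu> c k f x =
    (\<lambda>j. - \<i> * (-1) ^ (\<Sum>i<k. of_bool (x i)) * RN_factor \<mu> k x * c k x (f (x \<oplus>\<^sub>2 delta k)) j)"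

definition opJ' ::
  "seqX measure \<Rightarrow> (nat \<Rightarrow> seqX \<Rightarrow> (nat \<Rightarrow> complex) \<Rightarrow> nat \<Rightarrow> complex) \<Rightarrow> nat \<Rightarrow>
   (seqX \<Rightarrow> nat \<Rightarrow> complex) \<Rightarrow> seqX \<Rightarrow> nat \<Rightarrow> complex"
  where "opJ' \<mu> c k f x =
    (\<lambda>j. (-1) ^ (\<Sum>i\<le>k. of_bool (x i)) * RN_factor \<mu> k x * c k x (f (x \<oplus>\<^sub>2 delta k)) j)"

text \<open>The scalar field \<open>K\<close> is \<open>UNIV\<close> for complex-linear and \<open>\<real>\<close> for real-linear subspaces.\<close>

definition closed_subspace ::
  "complex set \<Rightarrow> seqX measure \<Rightarrow> (seqX \<Rightarrow> enat) \<Rightarrow> (seqX \<Rightarrow> nat \<Rightarrow> complex) set \<Rightarrow> bool"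
  where "closed_subspace K \<mu> \<nu> W \<longleftrightarrow>
    W \<subseteq> direct_integral \<mu> \<nu> \<and>
    (\<lambda>x j. 0) \<in> W \<and>
    (\<forall>f\<in>W. \<forall>g\<in>W. (\<lambda>x j. f x j + g x j) \<in> W) \<and>
    (\<forall>a\<in>K. \<forall>f\<in>W. (\<lambda>x j. a * f x j) \<in> W) \<and>
    (\<forall>s. \<forall>f\<in>direct_integral \<mu> \<nu>. (\<forall>n. s n \<in> W) \<longrightarrow>
       (\<lambda>n. sq_norm \<mu> (\<lambda>x j. s n x j - f x j)) \<longlonglongrightarrow> 0 \<longrightarrow> f \<in> W)"

definition irreducible_over ::
  "complex set \<Rightarrow> seqX measure \<Rightarrow> (seqX \<Rightarrow> enat) \<Rightarrow>
   (nat \<Rightarrow> seqX \<Rightarrow> (nat \<Rightarrow> complex) \<Rightarrow> nat \<Rightarrow> complex) \<Rightarrow> bool"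
  where "irreducible_over K \<mu> \<nu> c \<longleftrightarrow>
    direct_integral \<mu> \<nu> \<noteq> null_fields \<mu> \<nu> \<and>
    (\<forall>W. closed_subspace K \<mu> \<nu> W \<longrightarrow>
       (\<forall>k. \<forall>f\<in>W. opJ \<mu> c k f \<in> W \<and> opJ' \<mu> c k f \<in> W) \<longrightarrow>
       W = null_fields \<mu> \<nu> \<or> W = direct_integral \<mu> \<nu>)"

abbreviation irreducible_complex
  where "irreducible_complex \<equiv> irreducible_over UNIV"

abbreviation irreducible_real
  where "irreducible_real \<equiv> irreducible_over \<real>"

definition mu_Delta :: "seqX measure"
  where "mu_Delta = distr (count_space Delta) borel (\<lambda>x. x)"

definition fock_nu :: "seqX \<Rightarrow> enat"
  where "fock_nu x = 1"

definition fock_c :: "nat \<Rightarrow> seqX \<Rightarrow> (nat \<Rightarrow> complex) \<Rightarrow> nat \<Rightarrow> complex"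
  where "fock_c k x v = v"

end

theory Submission
  imports Defs
begin

text \<open>
  The operator \<open>J\<^sub>k J\<^sub>k'\<close> is multiplication by \<open>\<i> (-1)\<^bsup>x\<^sub>k\<^esup>\<close>. If \<open>\<mu>\<close> is discrete and \<open>V\<close> is irreducible
  over \<open>\<complex>\<close>, then the atoms of \<open>\<mu>\<close> form a single orbit \<open>a + \<Delta>\<close>, and on this orbit \<open>(-1)\<^bsup>x\<^sub>k\<^esup>\<close> is
  eventually equal to \<open>(-1)\<^bsup>a\<^sub>k\<^esup>\<close>. Hence \<open>(-1)\<^bsup>a\<^sub>k\<^esup> J\<^sub>k J\<^sub>k' f\<close> converges to \<open>\<i> f\<close> by dominated
  convergence, and every closed real-linear invariant subspace is complex-linear.

  In the Fock case a complex invariant subspace is closed under restriction to cylinders, so a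
  nonzero element yields a point mass at some \<open>a \<in> \<Delta>\<close>; the operators \<open>J\<^sub>k'\<close> move it to all of \<open>\<Delta>\<close>,
  and the point masses span a dense subspace.
\<close>

section \<open>Translations and model spaces\<close>

lemma plusX_cancel [simp]: "x \<oplus>\<^sub>2 y \<oplus>\<^sub>2 y = x" "x \<oplus>\<^sub>2 (x \<oplus>\<^sub>2 y) = y"
  by (auto simp: plusX_def)

lemma plusX_assoc: "x \<oplus>\<^sub>2 y \<oplus>\<^sub>2 z = x \<oplus>\<^sub>2 (y \<oplus>\<^sub>2 z)"
  by (auto simp: plusX_def)

lemma bij_plusX: "bij (\<lambda>x. x \<oplus>\<^sub>2 d)"
  by (rule involuntory_imp_bij) simp

lemma plusX_eq_iff: "x \<oplus>\<^sub>2 d = a \<longleftrightarrow> x = a \<oplus>\<^sub>2 d"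
  by (metis plusX_cancel(1))

lemma Delta_iff: "x \<in> Delta \<longleftrightarrow> finite {k. x k}"
  by (simp add: Delta_def)

lemma delta_in_Delta [simp]: "delta k \<in> Delta"
  by (simp add: Delta_def delta_def)

lemma plusX_in_Delta: "x \<in> Delta \<Longrightarrow> y \<in> Delta \<Longrightarrow> x \<oplus>\<^sub>2 y \<in> Delta"
  unfolding Delta_iff plusX_def
  by (rule finite_subset[of _ "{k. x k} \<union> {k. y k}"]) auto

lemma plusX_delta_in_Delta_iff: "x \<oplus>\<^sub>2 delta k \<in> Delta \<longleftrightarrow> x \<in> Delta"
  by (metis plusX_cancel(1) plusX_in_Delta delta_in_Delta)

text \<open>Each coordinate of the translate depends on one coordinate only, through a map on a
  discrete space, so translation is continuous for the product topology.\<close>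

lemma measurable_plusX [measurable]: "(\<lambda>x. x \<oplus>\<^sub>2 d) \<in> borel \<rightarrow>\<^sub>M borel"
proof -
  have "continuous_on UNIV (\<lambda>x :: seqX. x k \<noteq> d k)" for k
    by (rule continuous_on_compose2[OF Topological_Spaces.continuous_on_discrete continuous_on_product_coordinates]) auto
  then have "continuous_on UNIV (\<lambda>x. x \<oplus>\<^sub>2 d)"
    unfolding plusX_def by (rule continuous_on_coordinatewise_then_product)
  then show ?thesis
    by (rule borel_measurable_continuous_onI)
qed

text \<open>A point is an intersection of clopen cylinders, hence closed.\<close>

lemma singleton_seqX_sets [simp]: "{x :: seqX} \<in> sets borel"
proof -
  have "open {x k}" for k
    by (rule open_discrete)
  then have "closed ((\<lambda>y :: seqX. y k) -` {x k})" for k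
    by (intro closed_vimage continuous_on_product_coordinates) (auto simp: closed_def open_discrete)
  then have "closed (\<Inter>k. (\<lambda>y :: seqX. y k) -` {x k})"
    by auto
  moreover have "(\<Inter>k. (\<lambda>y :: seqX. y k) -` {x k}) = {x}"
    by auto
  ultimately show ?thesis
    by (metis borel_closed)
qed

lemma sets_translate [simp]: "sets (translate d \<mu>) = sets borel"
  by (simp add: translate_def)

lemma emeasure_translate_singleton:
  assumes "sets \<mu> = sets borel"
  shows "emeasure (translate d \<mu>) {x} = emeasure \<mu> {x \<oplus>\<^sub>2 d}"
proof -
  have "(\<lambda>x. x \<oplus>\<^sub>2 d) \<in> \<mu> \<rightarrow>\<^sub>M borel"
    using assms by (simp cong: measurable_cong_sets)
  moreover have "(\<lambda>x. x \<oplus>\<^sub>2 d) -` {x} \<inter> space \<mu> = {x \<oplus>\<^sub>2 d}"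
    using sets_eq_imp_space_eq[OF assms] by (auto simp: plusX_eq_iff)
  ultimately show ?thesis
    by (simp add: translate_def emeasure_distr)
qed

section \<open>Norms and inner products on the fibres\<close>

text \<open>The squared l2 norm with values in \<open>ennreal\<close>, so that it makes sense
  without summability; it is the integrand of \<open>sq_norm\<close>.\<close>

definition norm2 :: "(nat \<Rightarrow> complex) \<Rightarrow> ennreal"
  where "norm2 v = (\<Sum>j. ennreal ((cmod (v j))\<^sup>2))"

lemma norm2_zero [simp]: "norm2 (\<lambda>j. 0) = 0"
  by (simp add: norm2_def)

lemma norm2_scale: "norm2 (\<lambda>j. a * v j) = ennreal ((cmod a)\<^sup>2) * norm2 v"
  by (simp add: norm2_def norm_mult power_mult_distrib ennreal_mult)

lemma sq_norm_norm2: "sq_norm \<mu> f = (\<integral>\<^sup>+x. norm2 (f x) \<partial>completion \<mu>)"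
  by (simp add: sq_norm_def norm2_def)

lemma norm2_eq_0_iff: "norm2 v = 0 \<longleftrightarrow> v = (\<lambda>j. 0)"
  by (auto simp: norm2_def suminf_eq_zero_iff fun_eq_iff)

text \<open>Links the extended-valued norm to the complex inner product preserved by unitaries; it
  also shows that \<open>norm2\<close> is finite on a model space.\<close>

lemma inner_l2_self:
  assumes "v \<in> model_space n"
  shows "inner_l2 v v = of_real (\<Sum>j. (cmod (v j))\<^sup>2)"
    and "norm2 v = ennreal (Re (inner_l2 v v))"
proof -
  have s: "summable (\<lambda>j. (cmod (v j))\<^sup>2)"
    using assms by (simp add: model_space_def)
  show 1: "inner_l2 v v = of_real (\<Sum>j. (cmod (v j))\<^sup>2)"
    using suminf_of_real[OF s, where ?'a=complex]
    by (simp add: inner_l2_def complex_norm_square[symmetric])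
  show "norm2 v = ennreal (Re (inner_l2 v v))"
    unfolding 1 using s by (simp add: norm2_def suminf_ennreal2)
qed

lemma norm2_unitary:
  assumes "unitary_between (model_space m) (model_space n) T" "v \<in> model_space m"
  shows "norm2 (T v) = norm2 v"
proof -
  have "T v \<in> model_space n" "inner_l2 (T v) (T v) = inner_l2 v v"
    using assms by (auto simp: unitary_between_def)
  then show ?thesis
    using inner_l2_self(2)[of "T v"] inner_l2_self(2)[OF assms(2)] by simp
qed

lemma unitary_scale:
  assumes "unitary_between V W T" "v \<in> V"
  shows "T (\<lambda>j. a * v j) = (\<lambda>j. a * T v j)"
proof -
  have "T (\<lambda>j. a * v j + 0 * v j) = (\<lambda>j. a * T v j + 0 * T v j)"
    using assms unfolding unitary_between_def by blast
  then show ?thesis by simp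
qed

lemma model_space_scale: "v \<in> model_space n \<Longrightarrow> (\<lambda>j. a * v j) \<in> model_space n"
  by (auto simp: model_space_def norm_mult power_mult_distrib)

lemma model_space_0: "(\<lambda>j. 0) \<in> model_space n"
  by (simp add: model_space_def)

lemma model_space_unit:
  assumes "enat i < n"
  shows "(\<lambda>j. of_bool (j = i)) \<in> model_space n"
proof -
  have "summable (\<lambda>j. (cmod (of_bool (j = i)))\<^sup>2)"
    by (rule summable_finite[of "{i}"]) auto
  then show ?thesis
    using assms by (auto simp: model_space_def)
qed

lemma inner_l2_unit: "inner_l2 v (\<lambda>j. of_bool (j = i)) = v i"
proof -
  have "inner_l2 v (\<lambda>j. of_bool (j = i)) = (\<Sum>j\<in>{i}. v j * cnj (of_bool (j = i)))"
    unfolding inner_l2_def by (rule suminf_finite) auto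
  then show ?thesis by simp
qed

text \<open>Pairing with the unit vectors recovers the first \<open>n\<close> coordinates, and the
  others vanish by definition of the model space.\<close>

lemma model_space_eqI:
  assumes "u \<in> model_space n" "v \<in> model_space n"
    and "\<And>w. w \<in> model_space n \<Longrightarrow> inner_l2 u w = inner_l2 v w"
  shows "u = v"
proof
  fix i
  show "u i = v i"
  proof (cases "enat i < n")
    case True
    then show ?thesis
      using assms(3)[OF model_space_unit[OF True]] by (simp add: inner_l2_unit)
  next
    case False
    then show ?thesis
      using assms(1,2) by (auto simp: model_space_def not_less)
  qed
qed

text \<open>A crude bound in place of the triangle inequality for the l2 norm: it serves only to
  show that sums have finite norm.\<close>

lemma norm_add_squared_le:
  fixes a b :: "'a :: real_normed_vector"
  shows "(norm (a + b))\<^sup>2 \<le> 2 * (norm a)\<^sup>2 + 2 * (norm b)\<^sup>2"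
proof -
  have "(norm (a + b))\<^sup>2 \<le> (norm a + norm b)\<^sup>2"
    by (intro power_mono norm_triangle_ineq) auto
  also have "\<dots> \<le> 2 * (norm a)\<^sup>2 + 2 * (norm b)\<^sup>2"
    using sum_squares_bound[of "norm a" "norm b"] by (simp add: power2_sum)
  finally show ?thesis .
qed

lemma model_space_add:
  assumes "u \<in> model_space n" "v \<in> model_space n"
  shows "(\<lambda>j. u j + v j) \<in> model_space n"
proof -
  have "summable (\<lambda>j. (cmod (u j + v j))\<^sup>2)"
  proof (rule summable_comparison_test')
    show "summable (\<lambda>j. 2 * (cmod (u j))\<^sup>2 + 2 * (cmod (v j))\<^sup>2)"
      using assms by (intro summable_add summable_mult) (auto simp: model_space_def)
    show "norm ((cmod (u j + v j))\<^sup>2) \<le> 2 * (cmod (u j))\<^sup>2 + 2 * (cmod (v j))\<^sup>2" for j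
      using norm_add_squared_le[of "u j" "v j"] by simp
  qed
  then show ?thesis
    using assms by (auto simp: model_space_def)
qed

lemma norm2_add_le: "norm2 (\<lambda>j. u j + v j) \<le> 2 * norm2 u + 2 * norm2 v"
proof -
  have "ennreal ((cmod (u j + v j))\<^sup>2)
      \<le> 2 * ennreal ((cmod (u j))\<^sup>2) + 2 * ennreal ((cmod (v j))\<^sup>2)" for j
  proof -
    have "ennreal ((cmod (u j + v j))\<^sup>2) \<le> ennreal (2 * (cmod (u j))\<^sup>2 + 2 * (cmod (v j))\<^sup>2)"
      by (intro ennreal_leI norm_add_squared_le)
    then show ?thesis
      by (simp add: ennreal_plus ennreal_mult)
  qed
  then have "norm2 (\<lambda>j. u j + v j)
      \<le> (\<Sum>j. 2 * ennreal ((cmod (u j))\<^sup>2) + 2 * ennreal ((cmod (v j))\<^sup>2))"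
    unfolding norm2_def by (intro suminf_le) auto
  also have "\<dots> = 2 * norm2 u + 2 * norm2 v"
    by (simp add: norm2_def suminf_add[symmetric])
  finally show ?thesis .
qed

lemma closed_subspace_limit:
  assumes "closed_subspace K \<mu> \<nu> W" "f \<in> direct_integral \<mu> \<nu>" "\<And>n. s n \<in> W"
    and "(\<lambda>n. sq_norm \<mu> (\<lambda>x j. s n x j - f x j)) \<longlonglongrightarrow> 0"
  shows "f \<in> W"
proof -
  have "\<forall>s. \<forall>f\<in>direct_integral \<mu> \<nu>. (\<forall>n. s n \<in> W) \<longrightarrow>
      (\<lambda>n. sq_norm \<mu> (\<lambda>x j. s n x j - f x j)) \<longlonglongrightarrow> 0 \<longrightarrow> f \<in> W"
    using assms(1) unfolding closed_subspace_def by (elim conjE)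
  from this[rule_format, OF assms(2,3,4)] show ?thesis .
qed

section \<open>Discrete triples\<close>

locale discrete_GW =
  fixes \<mu> :: "seqX measure" and \<nu> :: "seqX \<Rightarrow> enat"
    and c :: "nat \<Rightarrow> seqX \<Rightarrow> (nat \<Rightarrow> complex) \<Rightarrow> nat \<Rightarrow> complex"
  assumes GW: "GW_triple \<mu> \<nu> c" and discrete: "discrete_measure \<mu>"
begin

section \<open>Reduction of the measure to its atoms\<close>

definition atoms :: "seqX set"
  where "atoms = {x. emeasure \<mu> {x} \<noteq> 0}"

lemma sets_\<mu>: "sets \<mu> = sets borel"
  using GW by (simp add: GW_triple_def)

lemma space_\<mu> [simp]: "space \<mu> = UNIV"
  using sets_eq_imp_space_eq[OF sets_\<mu>] by simp

lemma sigma_finite: "sigma_finite_measure \<mu>"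
  using GW by (simp add: GW_triple_def)

lemma singleton_sets [simp]: "{x} \<in> sets \<mu>"
  by (simp add: sets_\<mu>)

text \<open>By sigma-finiteness every point lies in a set of finite measure.\<close>

lemma emeasure_singleton_finite: "emeasure \<mu> {x} < \<infinity>"
proof -
  obtain A where A: "range A \<subseteq> sets \<mu>" "(\<Union>i::nat. A i) = space \<mu>" "\<And>i. emeasure \<mu> (A i) \<noteq> \<infinity>"
    using sigma_finite_measure.sigma_finite[OF sigma_finite] by metis
  from A(2) obtain i where "x \<in> A i" by auto
  then have "emeasure \<mu> {x} \<le> emeasure \<mu> (A i)"
    using A(1) by (intro emeasure_mono) auto
  then show ?thesis
    using A(3)[of i] by (simp add: less_top order_le_less_trans)
qed

text \<open>A null set contains no atom, which gives one direction. Conversely, the countable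
  carrier \<open>D\<close> is treated point by point: its non-atoms are null singletons, and
  countably many null sets have a null union.\<close>

lemma AE_atoms: "(AE x in \<mu>. P x) \<longleftrightarrow> (\<forall>x\<in>atoms. P x)"
proof
  assume P: "AE x in \<mu>. P x"
  show "\<forall>x\<in>atoms. P x"
  proof (rule ccontr)
    assume "\<not> (\<forall>x\<in>atoms. P x)"
    then obtain x where x: "x \<in> atoms" "\<not> P x" by blast
    from P x(2) have "AE y in \<mu>. y \<notin> {x}" by (auto elim!: eventually_mono)
    then have "{x} \<in> null_sets \<mu>" using AE_iff_null_sets[of "{x}" \<mu>] by simp
    with x(1) show False by (simp add: atoms_def null_sets_def)
  qed
next
  assume P: "\<forall>x\<in>atoms. P x"
  obtain D where D: "countable D" "AE x in \<mu>. x \<in> D"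
    using discrete by (auto simp: discrete_measure_def)
  have "AE x in \<mu>. x = y \<longrightarrow> P x" for y
  proof (cases "y \<in> atoms")
    case False
    then have "{y} \<in> null_sets \<mu>" by (simp add: atoms_def null_sets_def)
    then have "AE x in \<mu>. x \<notin> {y}" by (rule AE_not_in)
    then show ?thesis by eventually_elim simp
  qed (use P in auto)
  then have "AE x in \<mu>. \<forall>y\<in>D. x = y \<longrightarrow> P x"
    by (intro AE_ball_countable[THEN iffD2, OF D(1)] ballI)
  then show "AE x in \<mu>. P x"
    using D(2) by eventually_elim auto
qed

text \<open>Any set splits into a countable part inside \<open>D\<close>, which is Borel, and a part
  inside the null complement of \<open>D\<close>. So \<open>measurable_field\<close> reduces to
  membership in the fibres.\<close>

lemma sets_completion_UNIV: "sets (completion \<mu>) = UNIV"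
proof -
  obtain D where D: "countable D" "AE x in \<mu>. x \<in> D"
    using discrete by (auto simp: discrete_measure_def)
  have meas: "C \<in> sets \<mu>" if "C \<subseteq> D" for C
    using that D(1) by (metis countable_subset sets.countable singleton_sets)
  have "- D \<in> sets \<mu>" using meas[of D] by (metis Compl_eq_Diff_UNIV order_refl sets.compl_sets space_\<mu>)
  then have "- D \<in> null_sets \<mu>"
    using D(2) AE_iff_null_sets[of "- D" \<mu>] by simp
  then have "A - D \<in> sets (completion \<mu>)" for A
    by (rule sets_completionI_sub) auto
  moreover have "A \<inter> D \<in> sets (completion \<mu>)" for A
    using meas[of "A \<inter> D"] by simp
  ultimately have "(A \<inter> D) \<union> (A - D) \<in> sets (completion \<mu>)" for A
    by blast
  then show ?thesis by (auto simp: Int_Diff_Un)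
qed

lemma measurable_completion_any: "f \<in> completion \<mu> \<rightarrow>\<^sub>M N" if "range f \<subseteq> space N"
  using that by (auto simp: measurable_def sets_completion_UNIV)

lemma measurable_completion_borel [simp]: "f \<in> borel_measurable (completion \<mu>)"
  by (rule measurable_completion_any) simp

text \<open>All subsets being measurable, \<open>V\<close> is the weighted \<open>\<ell>\<^sup>2\<close>-sum of its fibres over the atoms.\<close>

lemma completion_density:
  "completion \<mu> = density (count_space UNIV) (\<lambda>x. emeasure \<mu> {x})"
proof -
  obtain D where D: "countable D" "AE x in \<mu>. x \<in> D"
    using discrete by (auto simp: discrete_measure_def)
  show ?thesis
  proof (rule measure_eqI_countable_AE[OF _ _ _ _ D(1)])
    show "AE x in completion \<mu>. x \<in> D"
      using D(2) by (rule AE_completion)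
    show "AE x in density (count_space UNIV) (\<lambda>x. emeasure \<mu> {x}). x \<in> D"
      using D(2) unfolding AE_atoms
      by (subst AE_density) (auto simp: AE_count_space atoms_def zero_less_iff_neq_zero)
    show "emeasure (completion \<mu>) {x}
        = emeasure (density (count_space UNIV) (\<lambda>x. emeasure \<mu> {x})) {x}" for x
      by (subst emeasure_density) (auto simp: nn_integral_count_space_indicator nn_integral_cmult)
  qed (auto simp: sets_completion_UNIV)
qed

lemma nn_integral_completion:
  "(\<integral>\<^sup>+x. F x \<partial>completion \<mu>) = (\<integral>\<^sup>+x. emeasure \<mu> {x} * F x \<partial>count_space UNIV)"
proof -
  have "integral\<^sup>N (density (count_space UNIV) (\<lambda>x. emeasure \<mu> {x})) F
      = (\<integral>\<^sup>+x. emeasure \<mu> {x} * F x \<partial>count_space UNIV)"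
    by (rule nn_integral_density) simp_all
  then show ?thesis
    by (simp only: completion_density)
qed

text \<open>If the translated point had mass zero, the point itself would be null for the translated
  measure and then, by quasi-invariance, for \<open>\<mu>\<close>.\<close>

lemma atoms_translate: "x \<in> atoms \<Longrightarrow> d \<in> Delta \<Longrightarrow> x \<oplus>\<^sub>2 d \<in> atoms"
proof (rule ccontr)
  assume "x \<in> atoms" "d \<in> Delta" "x \<oplus>\<^sub>2 d \<notin> atoms"
  then have "{x} \<in> null_sets (translate d \<mu>)"
    by (simp add: atoms_def null_sets_def emeasure_translate_singleton[OF sets_\<mu>])
  moreover have "absolutely_continuous (translate d \<mu>) \<mu>"
    using GW \<open>d \<in> Delta\<close> by (simp add: GW_triple_def quasi_invariant_def)
  ultimately have "{x} \<in> null_sets \<mu>"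
    by (auto simp: absolutely_continuous_def)
  then show False
    using \<open>x \<in> atoms\<close> by (simp add: atoms_def null_sets_def)
qed

lemma atoms_delta_iff [simp]: "x \<oplus>\<^sub>2 delta k \<in> atoms \<longleftrightarrow> x \<in> atoms"
  by (metis atoms_translate delta_in_Delta plusX_cancel(1))

section \<open>Radon-Nikodym factors as ratios of point masses\<close>

lemma measure_atom_pos: "x \<in> atoms \<Longrightarrow> measure \<mu> {x} > 0"
  using emeasure_singleton_finite[of x]
  by (simp add: atoms_def measure_def enn2real_positive_iff zero_less_iff_neq_zero)

lemma emeasure_singleton: "emeasure \<mu> {x} = ennreal (measure \<mu> {x})"
  using emeasure_singleton_finite[of x] by (simp add: emeasure_eq_ennreal_measure)

text \<open>Evaluating the density on a singleton pins down the derivative at an atom, although in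
  general it is determined only almost everywhere.\<close>

lemma RN_factor_atom:
  assumes "x \<in> atoms"
  shows "RN_factor \<mu> k x = of_real (sqrt (measure \<mu> {x \<oplus>\<^sub>2 delta k} / measure \<mu> {x}))"
proof -
  let ?R = "RN_deriv \<mu> (translate (delta k) \<mu>)"
  have "density \<mu> ?R = translate (delta k) \<mu>"
    using GW by (intro sigma_finite_measure.density_RN_deriv[OF sigma_finite])
      (auto simp: GW_triple_def quasi_invariant_def sets_\<mu>)
  then have "emeasure \<mu> {x \<oplus>\<^sub>2 delta k} = emeasure (density \<mu> ?R) {x}"
    by (simp add: emeasure_translate_singleton sets_\<mu>)
  also have "\<dots> = ?R x * emeasure \<mu> {x}"
    by (subst emeasure_density) (auto simp: nn_integral_indicator_singleton)
  finally have "measure \<mu> {x \<oplus>\<^sub>2 delta k} = enn2real (?R x) * measure \<mu> {x}"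
    by (simp add: measure_def enn2real_mult)
  then show ?thesis
    using measure_atom_pos[OF assms] by (simp add: RN_factor_def field_simps)
qed

text \<open>The mass ratios at two neighbouring points are reciprocal.\<close>

lemma RN_factor_mult:
  assumes "x \<in> atoms"
  shows "RN_factor \<mu> k x * RN_factor \<mu> k (x \<oplus>\<^sub>2 delta k) = 1"
proof -
  have "measure \<mu> {x} > 0" "measure \<mu> {x \<oplus>\<^sub>2 delta k} > 0"
    using assms by (auto intro: measure_atom_pos)
  then show ?thesis
    using assms by (simp add: RN_factor_atom real_sqrt_divide flip: of_real_mult)
qed

text \<open>The change of variables that makes \<open>opJ\<close> and \<open>opJ'\<close> isometric.
  Off the atoms both sides vanish, because the set of atoms is invariant.\<close>

lemma emeasure_RN_factor:
  "emeasure \<mu> {x} * ennreal ((cmod (RN_factor \<mu> k x))\<^sup>2) = emeasure \<mu> {x \<oplus>\<^sub>2 delta k}"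
proof (cases "x \<in> atoms")
  case True
  have "measure \<mu> {x} > 0"
    using True by (rule measure_atom_pos)
  then show ?thesis
    using True by (simp add: RN_factor_atom emeasure_singleton flip: ennreal_mult)
next
  case False
  then have "x \<oplus>\<^sub>2 delta k \<notin> atoms" by simp
  with False show ?thesis by (simp add: atoms_def)
qed

section \<open>The direct integral over the atoms and the operators on it\<close>

lemma measurable_field_iff: "measurable_field \<mu> \<nu> f \<longleftrightarrow> (\<forall>x\<in>atoms. f x \<in> model_space (\<nu> x))"
  by (simp add: measurable_field_def AE_atoms)

lemma direct_integral_iff:
  "f \<in> direct_integral \<mu> \<nu> \<longleftrightarrow> (\<forall>x\<in>atoms. f x \<in> model_space (\<nu> x)) \<and> sq_norm \<mu> f < \<infinity>"
  by (simp add: direct_integral_def measurable_field_iff)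

lemma null_fields_iff:
  "f \<in> null_fields \<mu> \<nu> \<longleftrightarrow> f \<in> direct_integral \<mu> \<nu> \<and> (\<forall>x\<in>atoms. f x = (\<lambda>j. 0))"
  by (simp add: null_fields_def AE_atoms)

lemma \<nu>_pos: "0 < \<nu> x"
  using GW by (auto simp: GW_triple_def zero_less_iff_neq_zero)

lemma \<nu>_delta: "x \<in> atoms \<Longrightarrow> \<nu> (x \<oplus>\<^sub>2 delta k) = \<nu> x"
  using GW by (auto simp: GW_triple_def AE_atoms)

lemma c_unitary:
  assumes "x \<in> atoms"
  shows "unitary_between (model_space (\<nu> x)) (model_space (\<nu> x)) (c k x)"
proof -
  have "unitary_between (model_space (\<nu> x)) (model_space (\<nu> (x \<oplus>\<^sub>2 delta k))) (c k x)"
    using GW assms by (auto simp: GW_triple_def AE_atoms)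
  then show ?thesis using assms by (simp add: \<nu>_delta)
qed

lemma c_in_model_space:
  "x \<in> atoms \<Longrightarrow> v \<in> model_space (\<nu> x) \<Longrightarrow> c k x v \<in> model_space (\<nu> x)"
  using c_unitary[of x k] by (auto simp: unitary_between_def)

text \<open>In a triple the adjoint of \<open>c k x\<close> is the operator \<open>c k\<close> at
  the neighbouring point; since that operator is unitary, testing against every \<open>w\<close>
  shows the two to be inverse.\<close>

lemma c_involution:
  assumes x: "x \<in> atoms" and v: "v \<in> model_space (\<nu> x)"
  shows "c k x (c k (x \<oplus>\<^sub>2 delta k) v) = v"
proof (rule model_space_eqI)
  have y: "x \<oplus>\<^sub>2 delta k \<in> atoms" using x by simp
  have cin: "c k (x \<oplus>\<^sub>2 delta k) w \<in> model_space (\<nu> x)" if "w \<in> model_space (\<nu> x)" for w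
    using c_in_model_space[OF y, of w k] that x by (simp add: \<nu>_delta)
  then show "c k x (c k (x \<oplus>\<^sub>2 delta k) v) \<in> model_space (\<nu> x)"
    using x v by (simp add: c_in_model_space)
  fix w assume w: "w \<in> model_space (\<nu> x)"
  have "inner_l2 (c k x (c k (x \<oplus>\<^sub>2 delta k) v)) w
      = inner_l2 (c k (x \<oplus>\<^sub>2 delta k) v) (c k (x \<oplus>\<^sub>2 delta k) w)"
    using GW x w cin[OF v] by (auto simp: GW_triple_def AE_atoms)
  also have "\<dots> = inner_l2 v w"
    using c_unitary[OF y, of k] v w x by (simp add: unitary_between_def \<nu>_delta)
  finally show "inner_l2 (c k x (c k (x \<oplus>\<^sub>2 delta k) v)) w = inner_l2 v w" .
qed (rule v)

text \<open>Treats \<open>opJ\<close> and \<open>opJ'\<close> together, since they differ only in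
  the phase \<open>s\<close>. Fibrewise unitarity and the Radon-Nikodym factor make the map
  norm-preserving.\<close>

lemma weighted_translate_in_direct_integral:
  assumes f: "f \<in> direct_integral \<mu> \<nu>"
    and s: "\<And>x. cmod (s x) = 1"
    and g: "\<And>x. g x = (\<lambda>j. s x * RN_factor \<mu> k x * c k x (f (x \<oplus>\<^sub>2 delta k)) j)"
  shows "g \<in> direct_integral \<mu> \<nu>"
proof -
  have fx: "f (x \<oplus>\<^sub>2 delta k) \<in> model_space (\<nu> x)" if "x \<in> atoms" for x
    using f that by (metis direct_integral_iff \<nu>_delta atoms_delta_iff)
  have "emeasure \<mu> {x} * norm2 (g x) = emeasure \<mu> {x \<oplus>\<^sub>2 delta k} * norm2 (f (x \<oplus>\<^sub>2 delta k))" for x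
  proof (cases "x \<in> atoms")
    case True
    have "norm2 (g x) = ennreal ((cmod (RN_factor \<mu> k x))\<^sup>2) * norm2 (f (x \<oplus>\<^sub>2 delta k))"
      unfolding g norm2_scale norm2_unitary[OF c_unitary[OF True] fx[OF True]]
      by (simp add: norm_mult s)
    then show ?thesis
      by (simp add: emeasure_RN_factor flip: mult.assoc)
  next
    case False
    then have "x \<oplus>\<^sub>2 delta k \<notin> atoms" by simp
    with False show ?thesis by (simp add: atoms_def)
  qed
  then have "sq_norm \<mu> g
      = (\<integral>\<^sup>+x. emeasure \<mu> {x \<oplus>\<^sub>2 delta k} * norm2 (f (x \<oplus>\<^sub>2 delta k)) \<partial>count_space UNIV)"
    by (simp add: sq_norm_norm2 nn_integral_completion)
  \<comment> \<open>Translation permutes the points, so the sum over all points can be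
    reindexed.\<close>
  also have "\<dots> = sq_norm \<mu> f"
    using nn_integral_bij_count_space[OF bij_plusX, of "\<lambda>x. emeasure \<mu> {x} * norm2 (f x)"]
    by (simp add: sq_norm_norm2 nn_integral_completion)
  finally show ?thesis
    using f fx by (simp add: direct_integral_iff g model_space_scale c_in_model_space)
qed

lemma opJ_in_direct_integral:
  assumes "f \<in> direct_integral \<mu> \<nu>"
  shows "opJ \<mu> c k f \<in> direct_integral \<mu> \<nu>" and "opJ' \<mu> c k f \<in> direct_integral \<mu> \<nu>"
proof -
  show "opJ \<mu> c k f \<in> direct_integral \<mu> \<nu>"
    by (rule weighted_translate_in_direct_integral[OF assms, where k=k and s="\<lambda>x. - \<i> * (-1) ^ (\<Sum>i<k. of_bool (x i))"])
      (auto simp: opJ_def norm_mult norm_power)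
  show "opJ' \<mu> c k f \<in> direct_integral \<mu> \<nu>"
    by (rule weighted_translate_in_direct_integral[OF assms, where k=k and s="\<lambda>x. (-1) ^ (\<Sum>i\<le>k. of_bool (x i))"])
      (auto simp: opJ'_def norm_mult norm_power)
qed

text \<open>The two translations cancel, the two unitaries are inverse and the two Radon-Nikodym
  factors reciprocal. The signs of the positions below \<open>k\<close> square to one, so only the
  sign at \<open>k\<close> survives.\<close>

lemma opJ_opJ':
  assumes f: "f \<in> direct_integral \<mu> \<nu>" and x: "x \<in> atoms"
  shows "opJ \<mu> c k (opJ' \<mu> c k f) x = (\<lambda>j. \<i> * (-1) ^ of_bool (x k) * f x j)"
proof -
  let ?y = "x \<oplus>\<^sub>2 delta k"
  define s :: complex where "s = (-1) ^ (\<Sum>i<k. of_bool (x i))"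
  have ss: "s * s = 1"
    by (simp add: s_def flip: power_add)
  have y: "?y \<in> atoms" using x by simp
  have fx: "f x \<in> model_space (\<nu> x)" using f x by (simp add: direct_integral_iff)
  have cfx: "c k ?y (f x) \<in> model_space (\<nu> x)"
    using c_in_model_space[OF y, of "f x" k] fx x by (simp add: \<nu>_delta)
  have "(\<Sum>i<k. of_bool (?y i)) = (\<Sum>i<k. of_bool (x i) :: nat)"
    by (rule sum.cong) (auto simp: plusX_def delta_def)
  \<comment> \<open>The sign in \<open>opJ'\<close> includes position \<open>k\<close> itself, which
    the translation flips; this is the source of the extra minus.\<close>
  then have sy: "(-1) ^ (\<Sum>i\<le>k. of_bool (?y i)) = - s * (-1) ^ of_bool (x k)"
    by (simp add: s_def plusX_def delta_def power_add flip: lessThan_Suc_atMost)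
  \<comment> \<open>The whole scalar of \<open>opJ'\<close> at the neighbouring point, collected so
    that linearity carries it through \<open>c k x\<close>.\<close>
  define z where "z = - s * (-1) ^ of_bool (x k) * RN_factor \<mu> k ?y"
  have "opJ' \<mu> c k f ?y = (\<lambda>j. z * c k ?y (f x) j)"
    unfolding opJ'_def sy plusX_cancel z_def ..
  then have cz: "c k x (opJ' \<mu> c k f ?y) = (\<lambda>j. z * f x j)"
    by (simp only: unitary_scale[OF c_unitary[OF x] cfx] c_involution[OF x fx])
  have "s * RN_factor \<mu> k x * z
      = - (s * s) * (RN_factor \<mu> k x * RN_factor \<mu> k ?y) * (-1) ^ of_bool (x k)"
    by (simp only: z_def mult.assoc mult.commute mult.left_commute mult_minus_left mult_minus_right)
  then have "s * RN_factor \<mu> k x * z = - ((-1) ^ of_bool (x k))"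
    by (simp only: ss RN_factor_mult[OF x]) simp
  then have "- \<i> * s * RN_factor \<mu> k x * (z * w) = \<i> * (-1) ^ of_bool (x k) * w" for w
    by (metis (no_types, lifting) minus_mult_minus mult.assoc mult_minus_left)
  then show ?thesis
    unfolding opJ_def s_def[symmetric] cz by simp
qed

section \<open>Closed subspaces and bounded multipliers\<close>

text \<open>Closed subspaces contain all null fields, so values off the atoms are irrelevant.\<close>

lemma closed_subspace_cong:
  assumes "closed_subspace K \<mu> \<nu> W" "f \<in> W" "\<And>x. x \<in> atoms \<Longrightarrow> g x = f x"
  shows "g \<in> W"
proof -
  have sq: "sq_norm \<mu> g = sq_norm \<mu> f" "sq_norm \<mu> (\<lambda>x j. f x j - g x j) = 0"
    unfolding sq_norm_norm2
    by (auto simp: nn_integral_0_iff_AE AE_completion_iff AE_atoms norm2_eq_0_iff assms(3)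
        intro!: nn_integral_cong_AE)
  have "f \<in> direct_integral \<mu> \<nu>"
    using assms(1,2) by (auto simp: closed_subspace_def)
  then have "g \<in> direct_integral \<mu> \<nu>"
    using sq assms(3) by (simp add: direct_integral_iff)
  \<comment> \<open>The constant sequence \<open>f\<close> converges to \<open>g\<close> in the
    seminorm, so closedness applies to it.\<close>
  moreover have "(\<lambda>n::nat. sq_norm \<mu> (\<lambda>x j. f x j - g x j)) \<longlonglongrightarrow> 0"
    by (simp add: sq)
  ultimately show ?thesis
    using closed_subspace_limit[OF assms(1), of g "\<lambda>n. f"] assms(2) by blast
qed

text \<open>Dominated convergence with majorant \<open>C\<^sup>2\<close> times
  \<open>norm2 (f x)\<close>; almost everywhere convergence is convergence at the atoms.\<close>

lemma sq_norm_multiplier_tendsto_0: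
  assumes f: "f \<in> direct_integral \<mu> \<nu>"
    and le: "\<And>n x. cmod (\<phi> n x) \<le> C"
    and lim: "\<And>x. x \<in> atoms \<Longrightarrow> (\<lambda>n. \<phi> n x) \<longlonglongrightarrow> 0"
  shows "(\<lambda>n. sq_norm \<mu> (\<lambda>x j. \<phi> n x * f x j)) \<longlonglongrightarrow> 0"
proof -
  let ?F = "\<lambda>n x. ennreal ((cmod (\<phi> n x))\<^sup>2) * norm2 (f x)"
  have "(\<lambda>n. integral\<^sup>N (completion \<mu>) (?F n)) \<longlonglongrightarrow> (\<integral>\<^sup>+x. 0 \<partial>completion \<mu>)"
  proof (rule nn_integral_dominated_convergence)
    show "AE x in completion \<mu>. ?F n x \<le> ennreal (C\<^sup>2) * norm2 (f x)" for n
      using le by (intro AE_I2 mult_right_mono ennreal_leI power_mono) auto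
    show "(\<integral>\<^sup>+x. ennreal (C\<^sup>2) * norm2 (f x) \<partial>completion \<mu>) < \<infinity>"
      using f by (simp add: nn_integral_cmult direct_integral_iff sq_norm_norm2 ennreal_mult_less_top)
    show "AE x in completion \<mu>. (\<lambda>n. ?F n x) \<longlonglongrightarrow> 0"
      unfolding AE_completion_iff AE_atoms
    proof
      fix x assume x: "x \<in> atoms"
      have "(\<lambda>n. ennreal ((cmod (\<phi> n x))\<^sup>2)) \<longlonglongrightarrow> ennreal 0"
        using tendsto_power[OF tendsto_norm_zero[OF lim[OF x]], of 2]
        by (intro tendsto_ennrealI) simp
      \<comment> \<open>Multiplication by a constant preserves limits in \<open>ennreal\<close> when
        the constant is finite.\<close>
      moreover have "norm2 (f x) < \<infinity>"
        using f x by (auto simp: direct_integral_iff inner_l2_self(2))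
      ultimately show "(\<lambda>n. ?F n x) \<longlonglongrightarrow> 0"
        using ennreal_tendsto_cmult[of "norm2 (f x)"] by (fastforce simp: mult.commute)
    qed
  qed auto
  then show ?thesis
    by (simp add: sq_norm_norm2 norm2_scale)
qed

lemma multiplier_in_direct_integral:
  assumes f: "f \<in> direct_integral \<mu> \<nu>" and le: "\<And>x. cmod (\<phi> x) \<le> C"
  shows "(\<lambda>x j. \<phi> x * f x j) \<in> direct_integral \<mu> \<nu>"
proof -
  have "sq_norm \<mu> (\<lambda>x j. \<phi> x * f x j) \<le> (\<integral>\<^sup>+x. ennreal (C\<^sup>2) * norm2 (f x) \<partial>completion \<mu>)"
    unfolding sq_norm_norm2 norm2_scale
    using le by (intro nn_integral_mono mult_right_mono ennreal_leI power_mono) auto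
  also have "\<dots> < \<infinity>"
    using f by (simp add: nn_integral_cmult direct_integral_iff sq_norm_norm2 ennreal_mult_less_top)
  finally show ?thesis
    using f by (simp add: direct_integral_iff model_space_scale)
qed

text \<open>The form in which closedness is used later: uniformly bounded multipliers that converge
  at each atom converge in norm when applied to \<open>f\<close>.\<close>

lemma closed_subspace_multiplier_limit:
  assumes W: "closed_subspace K \<mu> \<nu> W" and f: "f \<in> direct_integral \<mu> \<nu>"
    and le: "\<And>n x. cmod (\<phi> n x) \<le> C" "\<And>x. cmod (\<psi> x) \<le> C"
    and lim: "\<And>x. x \<in> atoms \<Longrightarrow> (\<lambda>n. \<phi> n x) \<longlonglongrightarrow> \<psi> x"
    and mem: "\<And>n. (\<lambda>x j. \<phi> n x * f x j) \<in> W"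
  shows "(\<lambda>x j. \<psi> x * f x j) \<in> W"
proof -
  have "(\<lambda>n. sq_norm \<mu> (\<lambda>x j. (\<phi> n x - \<psi> x) * f x j)) \<longlonglongrightarrow> 0"
  proof (rule sq_norm_multiplier_tendsto_0[OF f])
    show "cmod (\<phi> n x - \<psi> x) \<le> C + C" for n x
      using norm_triangle_ineq4[of "\<phi> n x" "\<psi> x"] le(1)[of n x] le(2)[of x] by simp
    show "(\<lambda>n. \<phi> n x - \<psi> x) \<longlonglongrightarrow> 0" if "x \<in> atoms" for x
      using lim[OF that] by (simp add: LIM_zero)
  qed
  then have "(\<lambda>n. sq_norm \<mu> (\<lambda>x j. \<phi> n x * f x j - \<psi> x * f x j)) \<longlonglongrightarrow> 0"
    by (simp only: left_diff_distrib)
  from closed_subspace_limit[OF W multiplier_in_direct_integral[OF f le(2)] mem this]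
  show ?thesis .
qed

section \<open>Fields with prescribed support and point masses\<close>

lemma sq_norm_zero: "sq_norm \<mu> (\<lambda>x j. 0) = 0"
  by (simp add: sq_norm_norm2)

lemma direct_integral_add:
  assumes "f \<in> direct_integral \<mu> \<nu>" "g \<in> direct_integral \<mu> \<nu>"
  shows "(\<lambda>x j. f x j + g x j) \<in> direct_integral \<mu> \<nu>"
proof -
  have "sq_norm \<mu> (\<lambda>x j. f x j + g x j) \<le> (\<integral>\<^sup>+x. 2 * norm2 (f x) + 2 * norm2 (g x) \<partial>completion \<mu>)"
    unfolding sq_norm_norm2 by (intro nn_integral_mono norm2_add_le)
  also have "\<dots> < \<infinity>"
    using assms
    by (simp add: nn_integral_add nn_integral_cmult direct_integral_iff sq_norm_norm2 ennreal_mult_less_top)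
  finally show ?thesis
    using assms by (simp add: direct_integral_iff model_space_add)
qed

text \<open>An atom has positive mass, so the norm controls the value of a field there and norm
  limits inherit its vanishing.\<close>

lemma sq_norm_limit_vanishes:
  assumes "(\<lambda>n::nat. sq_norm \<mu> (\<lambda>x j. s n x j - f x j)) \<longlonglongrightarrow> 0"
    and x: "x \<in> atoms" and s: "\<And>n. s n x = (\<lambda>j. 0)"
  shows "f x = (\<lambda>j. 0)"
proof -
  have neg: "norm2 (\<lambda>j. - f x j) = norm2 (f x)"
    by (simp add: norm2_def)
  have "emeasure \<mu> {x} * norm2 (f x) \<le> sq_norm \<mu> (\<lambda>x j. s n x j - f x j)" for n
  proof -
    have "emeasure \<mu> {x} * norm2 (f x)
        = (\<integral>\<^sup>+y. norm2 (\<lambda>j. s n y j - f y j) * indicator {x} y \<partial>completion \<mu>)"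
      by (subst nn_integral_indicator_singleton) (auto simp: s neg mult.commute)
    also have "\<dots> \<le> sq_norm \<mu> (\<lambda>x j. s n x j - f x j)"
      unfolding sq_norm_norm2 by (intro nn_integral_mono) (auto split: split_indicator)
    finally show ?thesis .
  qed
  then have "emeasure \<mu> {x} * norm2 (f x) \<le> 0"
    by (intro LIMSEQ_le_const[OF assms(1)]) auto
  then show ?thesis
    using x by (simp add: atoms_def norm2_eq_0_iff)
qed

text \<open>With an orbit for \<open>B\<close> this is the subspace to which complex irreducibility
  is applied.\<close>

lemma closed_subspace_supported:
  "closed_subspace K \<mu> \<nu> {f \<in> direct_integral \<mu> \<nu>. \<forall>x\<in>atoms - B. f x = (\<lambda>j. 0)}"
  unfolding closed_subspace_def
proof (intro conjI ballI allI impI)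
  fix s f assume "f \<in> direct_integral \<mu> \<nu>"
    and "\<forall>n::nat. s n \<in> {f \<in> direct_integral \<mu> \<nu>. \<forall>x\<in>atoms - B. f x = (\<lambda>j. 0)}"
    and "(\<lambda>n. sq_norm \<mu> (\<lambda>x j. s n x j - f x j)) \<longlonglongrightarrow> 0"
  then show "f \<in> {f \<in> direct_integral \<mu> \<nu>. \<forall>x\<in>atoms - B. f x = (\<lambda>j. 0)}"
    using sq_norm_limit_vanishes[of s f] by auto
next
  fix a f assume "f \<in> {f \<in> direct_integral \<mu> \<nu>. \<forall>x\<in>atoms - B. f x = (\<lambda>j. 0)}"
  then show "(\<lambda>x j. a * f x j) \<in> {f \<in> direct_integral \<mu> \<nu>. \<forall>x\<in>atoms - B. f x = (\<lambda>j. 0)}"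
    using multiplier_in_direct_integral[of f "\<lambda>x. a" "cmod a"] by auto
qed (auto simp: direct_integral_add direct_integral_iff[of "\<lambda>x j. 0"] model_space_0 sq_norm_zero)

text \<open>The first basis vector placed at a single point. It lies in the fibre because all fibres
  have positive dimension.\<close>

definition unit_at :: "seqX \<Rightarrow> seqX \<Rightarrow> nat \<Rightarrow> complex"
  where "unit_at a x = (\<lambda>j. of_bool (x = a \<and> j = 0))"

lemma unit_at_in_direct_integral: "unit_at a \<in> direct_integral \<mu> \<nu>"
proof -
  have "norm2 (\<lambda>j. of_bool (j = 0)) = 1"
  proof -
    have "norm2 (\<lambda>j. of_bool (j = 0)) = (\<Sum>j\<in>{0::nat}. ennreal ((cmod (of_bool (j = 0)))\<^sup>2))"
      unfolding norm2_def by (rule suminf_finite) auto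
    then show ?thesis by simp
  qed
  then have "norm2 (unit_at a x) = indicator {a} x" for x
    by (cases "x = a") (simp_all add: unit_at_def)
  then have "sq_norm \<mu> (unit_at a) = emeasure \<mu> {a}"
    by (simp add: sq_norm_norm2)
  moreover have "unit_at a x \<in> model_space (\<nu> x)" for x
    using model_space_unit[of 0 "\<nu> x"] \<nu>_pos[of x]
    by (cases "x = a") (simp_all add: unit_at_def model_space_0 zero_enat_def)
  ultimately show ?thesis
    using emeasure_singleton_finite[of a] by (simp add: direct_integral_iff)
qed

lemma unit_at_neq_0: "unit_at a a \<noteq> (\<lambda>j. 0)"
  by (auto simp: unit_at_def fun_eq_iff)

lemma c_zero: "x \<in> atoms \<Longrightarrow> c k x (\<lambda>j. 0) = (\<lambda>j. 0)"
  using unitary_scale[OF c_unitary[of x k] model_space_0, where a=0] by simp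

text \<open>The fields supported on the orbit of an atom \<open>a\<close> form an invariant closed
  subspace that is not null, hence all of \<open>V\<close>; this leaves no room for an atom outside
  the orbit.\<close>

lemma atoms_single_orbit:
  assumes irr: "irreducible_complex \<mu> \<nu> c"
  obtains a where "a \<in> atoms" "atoms = (\<lambda>d. a \<oplus>\<^sub>2 d) ` Delta"
proof -
  \<comment> \<open>Without atoms every field would be null, contrary to \<open>V\<close> being
    nonzero.\<close>
  have "\<exists>a. a \<in> atoms"
    using irr by (auto simp: irreducible_over_def null_fields_iff)
  then obtain a where a: "a \<in> atoms" ..
  let ?O = "(\<lambda>d. a \<oplus>\<^sub>2 d) ` Delta"
  let ?W = "{f \<in> direct_integral \<mu> \<nu>. \<forall>x\<in>atoms - ?O. f x = (\<lambda>j. 0)}"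
  have O: "x \<oplus>\<^sub>2 delta k \<in> ?O \<Longrightarrow> x \<in> ?O" for x k
  proof -
    assume "x \<oplus>\<^sub>2 delta k \<in> ?O"
    then obtain d where d: "d \<in> Delta" "x \<oplus>\<^sub>2 delta k = a \<oplus>\<^sub>2 d" by auto
    then have "x = a \<oplus>\<^sub>2 (d \<oplus>\<^sub>2 delta k)"
      by (metis plusX_assoc plusX_cancel(1))
    then show ?thesis using d(1) plusX_delta_in_Delta_iff by blast
  qed
  have "opJ \<mu> c k f \<in> ?W \<and> opJ' \<mu> c k f \<in> ?W" if f: "f \<in> ?W" for f k
  proof -
    \<comment> \<open>At \<open>x\<close> the operators read only the value at the neighbour, which
      is again an atom outside the orbit.\<close>
    have "f (x \<oplus>\<^sub>2 delta k) = (\<lambda>j. 0)" if "x \<in> atoms - ?O" for x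
      using f that O[of x k] by auto
    then show ?thesis
      using f opJ_in_direct_integral[of f k] by (auto simp: opJ_def opJ'_def c_zero)
  qed
  then have W: "?W = null_fields \<mu> \<nu> \<or> ?W = direct_integral \<mu> \<nu>"
    using irr closed_subspace_supported[of UNIV ?O] unfolding irreducible_over_def by blast
  have aO: "a \<in> ?O"
    by (rule image_eqI[of _ _ "\<lambda>k. False"]) (auto simp: plusX_def Delta_def)
  have "unit_at a x = (\<lambda>j. 0)" if "x \<notin> ?O" for x
  proof -
    from aO that have "x \<noteq> a" by blast
    then show ?thesis by (simp add: unit_at_def)
  qed
  then have "unit_at a \<in> ?W"
    using unit_at_in_direct_integral by blast
  moreover have "unit_at a \<notin> null_fields \<mu> \<nu>"
    using a unit_at_neq_0 by (auto simp: null_fields_iff)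
  ultimately have "?W = direct_integral \<mu> \<nu>"
    using W by blast
  \<comment> \<open>If an atom \<open>b\<close> were off the orbit, its point mass would have to
    vanish at \<open>b\<close>.\<close>
  then have "unit_at b \<in> ?W" for b
    using unit_at_in_direct_integral by blast
  then have "atoms \<subseteq> ?O"
    using unit_at_neq_0 by blast
  then show thesis
    using that[OF a] a atoms_translate by blast
qed

section \<open>From complex to real irreducibility\<close>

lemma irreducible_complex_imp_real:
  assumes irr: "irreducible_complex \<mu> \<nu> c"
  shows "irreducible_real \<mu> \<nu> c"
  unfolding irreducible_over_def
proof (intro conjI allI impI)
  show "direct_integral \<mu> \<nu> \<noteq> null_fields \<mu> \<nu>"
    using irr by (simp add: irreducible_over_def)
  fix W assume W: "closed_subspace \<real> \<mu> \<nu> W"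
    and inv: "\<forall>k. \<forall>f\<in>W. opJ \<mu> c k f \<in> W \<and> opJ' \<mu> c k f \<in> W"
  obtain a where a: "a \<in> atoms" "atoms = (\<lambda>d. a \<oplus>\<^sub>2 d) ` Delta"
    using atoms_single_orbit[OF irr] .
  define \<sigma> :: "nat \<Rightarrow> seqX \<Rightarrow> complex" where "\<sigma> k x = (-1) ^ of_bool (x k)" for k x
  have W_sub: "W \<subseteq> direct_integral \<mu> \<nu>"
    and W_add: "\<And>f g. f \<in> W \<Longrightarrow> g \<in> W \<Longrightarrow> (\<lambda>x j. f x j + g x j) \<in> W"
    and W_scale: "\<And>r f. r \<in> \<real> \<Longrightarrow> f \<in> W \<Longrightarrow> (\<lambda>x j. r * f x j) \<in> W"
    using W by (auto simp: closed_subspace_def)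
  have W_i: "(\<lambda>x j. \<i> * f x j) \<in> W" if f: "f \<in> W" for f
  proof (rule closed_subspace_multiplier_limit[OF W, where C=1 and \<phi>="\<lambda>n x. \<sigma> n a * (\<i> * \<sigma> n x)"])
    have fV: "f \<in> direct_integral \<mu> \<nu>" using f W_sub by auto
    then show "f \<in> direct_integral \<mu> \<nu>" .
    show "(\<lambda>x j. \<sigma> n a * (\<i> * \<sigma> n x) * f x j) \<in> W" for n
    proof (rule closed_subspace_cong[OF W])
      \<comment> \<open>The scalar \<open>\<sigma> n a\<close> is 1 or -1, hence real, so
        real-linearity of \<open>W\<close> suffices here.\<close>
      show "(\<lambda>x j. \<sigma> n a * opJ \<mu> c n (opJ' \<mu> c n f) x j) \<in> W"
        using inv f by (intro W_scale) (auto simp: \<sigma>_def)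
      show "(\<lambda>j. \<sigma> n a * (\<i> * \<sigma> n x) * f x j) = (\<lambda>j. \<sigma> n a * opJ \<mu> c n (opJ' \<mu> c n f) x j)"
        if "x \<in> atoms" for x
        using that fV by (simp add: opJ_opJ' \<sigma>_def mult.assoc)
    qed
    show "(\<lambda>n. \<sigma> n a * (\<i> * \<sigma> n x)) \<longlonglongrightarrow> \<i>" if x: "x \<in> atoms" for x
    proof (rule tendsto_eventually)
      obtain d where d: "d \<in> Delta" "x = a \<oplus>\<^sub>2 d" using a x by auto
      \<comment> \<open>Beyond the finite support of \<open>d\<close> the entries of
        \<open>x\<close> and \<open>a\<close> agree, so the two signs multiply to one.\<close>
      have "eventually (\<lambda>n. \<not> d n) sequentially"
        using d(1) by (simp add: Delta_def cofinite_eq_sequentially[symmetric] eventually_cofinite)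
      then show "eventually (\<lambda>n. \<sigma> n a * (\<i> * \<sigma> n x) = \<i>) sequentially"
        by eventually_elim (simp add: d(2) plusX_def \<sigma>_def)
    qed
  qed (auto simp: \<sigma>_def norm_mult)
  have "(\<lambda>x j. z * f x j) \<in> W" if f: "f \<in> W" for z f
  proof -
    have "(\<lambda>x j. of_real (Re z) * f x j + of_real (Im z) * (\<i> * f x j)) \<in> W"
      using f by (intro W_add W_scale W_i) auto
    moreover have "of_real (Re z) * w + of_real (Im z) * (\<i> * w) = z * w" for w
      by (metis complex_eq distrib_right mult.assoc mult.commute)
    ultimately show ?thesis by simp
  qed
  then have "closed_subspace UNIV \<mu> \<nu> W"
    using W unfolding closed_subspace_def by blast
  then show "W = null_fields \<mu> \<nu> \<or> W = direct_integral \<mu> \<nu>"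
    using irr inv unfolding irreducible_over_def by blast
qed

end

section \<open>The Fermi-Fock representation\<close>

lemma countable_Delta: "countable Delta"
proof -
  have "Delta = (\<lambda>F k. k \<in> F) ` {F :: nat set. finite F}"
    by (force simp: Delta_def image_iff)
  then show ?thesis
    by (metis countable_Collect_finite countable_image)
qed

lemma sets_mu_Delta [simp]: "sets mu_Delta = sets borel"
  by (simp add: mu_Delta_def)

lemma emeasure_mu_Delta: "A \<in> sets borel \<Longrightarrow> emeasure mu_Delta A = emeasure (count_space Delta) (A \<inter> Delta)"
  by (simp add: mu_Delta_def emeasure_distr)

lemma emeasure_mu_Delta_singleton: "emeasure mu_Delta {x} = indicator Delta x"
  by (cases "x \<in> Delta") (auto simp: emeasure_mu_Delta)

lemma Delta_compl_null: "- Delta \<in> null_sets mu_Delta"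
proof -
  have "Delta \<in> sets borel"
    by (rule sets.countable[OF _ countable_Delta]) simp
  then have "- Delta \<in> sets borel"
    using sets.compl_sets by (fastforce simp: Compl_eq_Diff_UNIV)
  then show ?thesis
    by (simp add: null_sets_def emeasure_mu_Delta)
qed

lemma AE_mu_Delta: "(\<And>x. x \<in> Delta \<Longrightarrow> P x) \<Longrightarrow> AE x in mu_Delta. P x"
  by (rule AE_I'[OF Delta_compl_null]) auto

lemma discrete_mu_Delta: "discrete_measure mu_Delta"
  unfolding discrete_measure_def by (intro exI[of _ Delta] conjI countable_Delta AE_mu_Delta)

lemma sigma_finite_mu_Delta: "sigma_finite_measure mu_Delta"
proof
  \<comment> \<open>A countable cover by the null complement of \<open>Delta\<close> and the points
    of \<open>Delta\<close>, each of mass one.\<close>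
  let ?A = "insert (- Delta) ((\<lambda>x. {x}) ` Delta)"
  show "\<exists>A. countable A \<and> A \<subseteq> sets mu_Delta \<and> \<Union> A = space mu_Delta \<and> (\<forall>a\<in>A. emeasure mu_Delta a \<noteq> \<infinity>)"
    using countable_Delta Delta_compl_null
    by (intro exI[of _ ?A]) (auto simp: emeasure_mu_Delta_singleton null_sets_def mu_Delta_def[THEN arg_cong[where f=space]])
qed

text \<open>Translation by \<open>d\<close> permutes \<open>Delta\<close> and so preserves its
  counting measure; quasi-invariance follows at once.\<close>

lemma translate_mu_Delta:
  assumes d: "d \<in> Delta"
  shows "translate d mu_Delta = mu_Delta"
proof -
  have "bij_betw (\<lambda>x. x \<oplus>\<^sub>2 d) Delta Delta"
    by (rule bij_betw_byWitness[of _ "\<lambda>x. x \<oplus>\<^sub>2 d"]) (auto intro: plusX_in_Delta d)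
  then have "distr (count_space Delta) (count_space Delta) (\<lambda>x. x \<oplus>\<^sub>2 d) = count_space Delta"
    by (rule distr_bij_count_space)
  then have "mu_Delta = distr (distr (count_space Delta) (count_space Delta) (\<lambda>x. x \<oplus>\<^sub>2 d)) borel (\<lambda>x. x)"
    by (simp add: mu_Delta_def)
  also have "\<dots> = distr (count_space Delta) borel (\<lambda>x. x \<oplus>\<^sub>2 d)"
    by (subst distr_distr) (auto simp: comp_def intro: plusX_in_Delta d)
  also have "\<dots> = translate d mu_Delta"
    unfolding translate_def mu_Delta_def by (subst distr_distr) (auto simp: comp_def)
  finally show ?thesis by simp
qed

lemma unitary_between_id: "unitary_between V V (\<lambda>v. v)"
  by (simp add: unitary_between_def)

lemma GW_fock: "GW_triple mu_Delta fock_nu fock_c"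
proof -
  have "quasi_invariant mu_Delta"
    by (simp add: quasi_invariant_def translate_mu_Delta absolutely_continuous_def)
  moreover have "fock_c k x = (\<lambda>v. v)" for k x
    by (simp add: fock_c_def fun_eq_iff)
  moreover have "fock_nu \<in> measurable (completion mu_Delta) (count_space UNIV)"
    unfolding fock_nu_def[abs_def] by simp
  ultimately show ?thesis
    by (simp add: GW_triple_def sigma_finite_mu_Delta fock_nu_def unitary_between_id)
qed

interpretation fock: discrete_GW mu_Delta fock_nu fock_c
  by unfold_locales (rule GW_fock discrete_mu_Delta)+

section \<open>Irreducibility of the Fock representation over the complex numbers\<close>

lemma fock_atoms: "fock.atoms = Delta"
  by (auto simp: fock.atoms_def emeasure_mu_Delta_singleton indicator_def)

text \<open>The fibres are one-dimensional, so on \<open>Delta\<close> a field amounts to the scalar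
  function \<open>f x 0\<close>.\<close>

lemma fock_field_zero:
  "f \<in> direct_integral mu_Delta fock_nu \<Longrightarrow> x \<in> Delta \<Longrightarrow> j \<noteq> 0 \<Longrightarrow> f x j = 0"
  by (auto simp: fock.direct_integral_iff fock_atoms model_space_def fock_nu_def one_enat_def)

text \<open>Each such sequence is given by a subset of \<open>{..<n}\<close>. As \<open>n\<close>
  grows these finite sets exhaust \<open>Delta\<close>, which allows truncation of a field.\<close>

lemma finite_seqX_supported: "finite {x :: seqX. \<forall>j\<ge>n. \<not> x j}"
proof (rule finite_subset)
  show "{x :: seqX. \<forall>j\<ge>n. \<not> x j} \<subseteq> (\<lambda>F k. k \<in> F) ` Pow {..<n}"
  proof
    fix x :: seqX assume "x \<in> {x. \<forall>j\<ge>n. \<not> x j}"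
    then have "x = (\<lambda>k. k \<in> {k. x k})" "{k. x k} \<in> Pow {..<n}"
      by (auto simp: not_le[symmetric])
    then show "x \<in> (\<lambda>F k. k \<in> F) ` Pow {..<n}" by (rule image_eqI)
  qed
qed simp

lemma irreducible_fock: "irreducible_complex mu_Delta fock_nu fock_c"
  unfolding irreducible_over_def
proof (intro conjI allI impI)
  let ?V = "direct_integral mu_Delta fock_nu" and ?N = "null_fields mu_Delta fock_nu"
  have "(\<lambda>k. False) \<in> Delta" by (simp add: Delta_def)
  then have "fock.unit_at (\<lambda>k. False) \<notin> ?N"
    using fock.unit_at_neq_0 by (auto simp: fock.null_fields_iff fock_atoms)
  then show "?V \<noteq> ?N"
    using fock.unit_at_in_direct_integral by blast
  fix W assume W: "closed_subspace UNIV mu_Delta fock_nu W"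
    and inv: "\<forall>k. \<forall>f\<in>W. opJ mu_Delta fock_c k f \<in> W \<and> opJ' mu_Delta fock_c k f \<in> W"
  have W_sub: "W \<subseteq> ?V" and W_zero: "(\<lambda>x j. 0) \<in> W"
    and W_add: "\<And>f g. f \<in> W \<Longrightarrow> g \<in> W \<Longrightarrow> (\<lambda>x j. f x j + g x j) \<in> W"
    and W_scale: "\<And>a f. f \<in> W \<Longrightarrow> (\<lambda>x j. a * f x j) \<in> W"
    using W by (auto simp: closed_subspace_def)
  have W_null: "?N \<subseteq> W"
    using fock.closed_subspace_cong[OF W W_zero] by (auto simp: fock.null_fields_iff)
  show "W = ?N \<or> W = ?V"
  proof (cases "W \<subseteq> ?N")
    case True
    then show ?thesis using W_null by blast
  next
    case False
    then obtain f where f: "f \<in> W" "f \<notin> ?N" by blast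
    have fV: "f \<in> ?V" using f(1) W_sub by auto
    then obtain a where a: "a \<in> Delta" "f a \<noteq> (\<lambda>j. 0)"
      using f(2) by (auto simp: fock.null_fields_iff fock_atoms)
    have fa: "f a 0 \<noteq> 0"
    proof
      assume "f a 0 = 0"
      then have "f a j = 0" for j
        using fock_field_zero[OF fV a(1)] by (cases "j = 0") auto
      then have "f a = (\<lambda>j. 0)" ..
      with a(2) show False ..
    qed
    have cyl: "(\<lambda>x j. of_bool (\<forall>k<n. x k = a k) * f x j) \<in> W" for n
    proof (induction n)
      case 0
      show ?case using f(1) by simp
    next
      case (Suc n)
      let ?g = "\<lambda>x j. of_bool (\<forall>k<n. x k = a k) * f x j"
      let ?h = "opJ mu_Delta fock_c n (opJ' mu_Delta fock_c n ?g)"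
      \<comment> \<open>At \<open>x\<close>, \<open>?s\<close> times \<open>?h\<close> is
        \<open>?g\<close> times 1 if \<open>x n = a n\<close> and times -1 otherwise. Averaging with
        \<open>?g\<close> is thus the projection onto the condition
        \<open>x n = a n\<close>.\<close>
      let ?s = "- \<i> * (-1) ^ of_bool (a n)"
      have gV: "?g \<in> ?V" using Suc W_sub by auto
      have "(\<lambda>x j. (1/2) * (?g x j + ?s * ?h x j)) \<in> W"
        using inv Suc by (intro W_scale W_add) auto
      then show ?case
      proof (rule fock.closed_subspace_cong[OF W])
        fix x assume x: "x \<in> fock.atoms"
        show "(\<lambda>j. of_bool (\<forall>k<Suc n. x k = a k) * f x j) = (\<lambda>j. (1/2) * (?g x j + ?s * ?h x j))"
          unfolding fock.opJ_opJ'[OF gV x] by (auto simp: less_Suc_eq fun_eq_iff)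
      qed
    qed
    \<comment> \<open>The cylinders around \<open>a\<close> shrink to the single point
      \<open>a\<close>.\<close>
    have "(\<lambda>x j. of_bool (x = a) * f x j) \<in> W"
    proof (rule fock.closed_subspace_multiplier_limit[OF W fV _ _ _ cyl, where C=1])
      fix x
      show "(\<lambda>n. of_bool (\<forall>k<n. x k = a k) :: complex) \<longlonglongrightarrow> of_bool (x = a)"
      proof (cases "x = a")
        case False
        then obtain k where "x k \<noteq> a k" by auto
        then have "eventually (\<lambda>n. of_bool (\<forall>k<n. x k = a k) = (of_bool (x = a) :: complex)) sequentially"
          using False by (intro eventually_sequentiallyI[of "Suc k"]) auto
        then show ?thesis by (rule tendsto_eventually)
      qed simp
    qed auto
    then have "(\<lambda>x j. (1 / f a 0) * (of_bool (x = a) * f x j)) \<in> W"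
      by (rule W_scale)
    moreover have "(\<lambda>x j. (1 / f a 0) * (of_bool (x = a) * f x j)) = fock.unit_at a"
      using fa fock_field_zero[OF fV a(1)] by (intro ext) (auto simp: fock.unit_at_def)
    ultimately have unit_a: "fock.unit_at a \<in> W" by simp
    have step: "fock.unit_at (b \<oplus>\<^sub>2 delta k) \<in> W" if b: "b \<in> Delta" "fock.unit_at b \<in> W" for b k
    proof -
      let ?b = "b \<oplus>\<^sub>2 delta k"
      \<comment> \<open>The scalar is taken at the target \<open>?b\<close>, since
        \<open>opJ'\<close> at \<open>x\<close> reads the field at the neighbour of
        \<open>x\<close>. It is nonzero because the Radon-Nikodym factor at an atom is
        invertible.\<close>
      let ?z = "(-1) ^ (\<Sum>i\<le>k. of_bool (?b i)) * RN_factor mu_Delta k ?b"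
      have "?z \<noteq> 0"
        using fock.RN_factor_mult[of ?b k] b(1) by (auto simp: fock_atoms plusX_delta_in_Delta_iff)
      moreover have "opJ' mu_Delta fock_c k (fock.unit_at b) = (\<lambda>x j. ?z * fock.unit_at ?b x j)"
        by (intro ext) (auto simp: opJ'_def fock_c_def fock.unit_at_def plusX_eq_iff)
      ultimately have "fock.unit_at ?b = (\<lambda>x j. (1 / ?z) * opJ' mu_Delta fock_c k (fock.unit_at b) x j)"
        by (simp add: fun_eq_iff)
      moreover have "opJ' mu_Delta fock_c k (fock.unit_at b) \<in> W"
        using inv b(2) by blast
      ultimately show ?thesis
        by (simp only: W_scale)
    qed
    \<comment> \<open>The entries of \<open>a\<close> at the positions in \<open>F\<close> are
      flipped one at a time.\<close>
    have move: "fock.unit_at (a \<oplus>\<^sub>2 (\<lambda>k. k \<in> F)) \<in> W" if "finite F" for F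
      using that
    proof induction
      case empty
      then show ?case using unit_a by (simp add: plusX_def)
    next
      case (insert k F)
      have "(\<lambda>k. k \<in> F) \<in> Delta" using insert by (simp add: Delta_def)
      moreover have "a \<oplus>\<^sub>2 (\<lambda>i. i \<in> insert k F) = a \<oplus>\<^sub>2 (\<lambda>k. k \<in> F) \<oplus>\<^sub>2 delta k"
        using insert by (auto simp: plusX_def delta_def fun_eq_iff)
      ultimately show ?case
        using step insert a(1) plusX_in_Delta by metis
    qed
    have unit_b: "fock.unit_at b \<in> W" if b: "b \<in> Delta" for b
    proof -
      \<comment> \<open>Flipping \<open>a\<close> exactly where it differs from \<open>b\<close>
        yields \<open>b\<close>.\<close>
      have "finite {k. (a \<oplus>\<^sub>2 b) k}"
        using plusX_in_Delta[OF a(1) b] by (simp add: Delta_def)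
      from move[OF this] show ?thesis by simp
    qed
    have "g \<in> W" if g: "g \<in> ?V" for g
    proof -
      have fin: "(\<lambda>x j. of_bool (x \<in> F) * g x j) \<in> W" if "finite F" "F \<subseteq> Delta" for F
        using that
      proof induction
        case empty
        then show ?case using W_zero by simp
      next
        case (insert b F)
        have "(\<lambda>x j. of_bool (x \<in> F) * g x j + g b 0 * fock.unit_at b x j) \<in> W"
          using insert unit_b by (intro W_add W_scale) auto
        moreover have "of_bool (x \<in> insert b F) * g x j
            = of_bool (x \<in> F) * g x j + g b 0 * fock.unit_at b x j" for x j
          using insert fock_field_zero[OF g, of b j] by (auto simp: fock.unit_at_def)
        ultimately show ?case by presburger
      qed
      \<comment> \<open>The constant multiplier 1 is the pointwise limit on \<open>Delta\<close> of
        truncations to sequences supported below \<open>n\<close>.\<close>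
      have "(\<lambda>x j. 1 * g x j) \<in> W"
      proof (rule fock.closed_subspace_multiplier_limit[OF W g, where C=1])
        show "(\<lambda>x j. of_bool (x \<in> {x. \<forall>j\<ge>n. \<not> x j}) * g x j) \<in> W" for n
        proof (rule fin[OF finite_seqX_supported], intro subsetI)
          fix x :: seqX assume "x \<in> {x. \<forall>j\<ge>n. \<not> x j}"
          then have "{k. x k} \<subseteq> {..<n}" by (auto simp: not_le[symmetric])
          then show "x \<in> Delta" by (simp add: Delta_def finite_subset)
        qed
        fix x assume "x \<in> fock.atoms"
        then have "finite {k. x k}" by (simp add: fock_atoms Delta_def)
        then obtain m where m: "\<And>k. x k \<Longrightarrow> k < m"
          using finite_nat_set_iff_bounded by auto
        have "eventually (\<lambda>n. of_bool (x \<in> {x. \<forall>j\<ge>n. \<not> x j}) = (1 :: complex)) sequentially"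
          using m by (intro eventually_sequentiallyI[of m]) (auto dest: leD le_less_trans)
        then show "(\<lambda>n. of_bool (x \<in> {x. \<forall>j\<ge>n. \<not> x j}) :: complex) \<longlonglongrightarrow> 1"
          by (rule tendsto_eventually)
      qed auto
      then show ?thesis by simp
    qed
    then show ?thesis using W_sub by blast
  qed
qed

theorem corollary3p4:
  shows "(\<forall>\<mu> \<nu> c. GW_triple \<mu> \<nu> c \<longrightarrow> discrete_measure \<mu> \<longrightarrow>
            irreducible_complex \<mu> \<nu> c \<longrightarrow> irreducible_real \<mu> \<nu> c) \<and>
         (GW_triple mu_Delta fock_nu fock_c \<and> discrete_measure mu_Delta \<and>
            irreducible_complex mu_Delta fock_nu fock_c \<and>
            irreducible_real mu_Delta fock_nu fock_c)"
  using discrete_GW.irreducible_complex_imp_real discrete_GW.intro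
    GW_fock discrete_mu_Delta irreducible_fock by blast

end
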